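(* Let $F:\mathbb{R}\times\mathbb{R}^n\to\mathbb{R}^n$ be locally Lipschitz in $x$ uniformly in $t$, with $t\mapsto F(t,x)$ locally integrable for each $x$. If the origin of $\dot x=F(t,x)$ is uniformly globally asymptotically stable (UGAS), then $F$ is uniformly $\delta$-persistently exciting (u$\delta$-PE) with respect to $x\in\mathbb{R}^n$.
   Context: $|\cdot|$ is the Euclidean norm. Standing assumption: solutions of $\dot x=F(t,x)$ exist over finite intervals; $x(\cdot,t_\circ,x_\circ)$ denotes a solution with initial condition $(t_\circ,x_\circ)$. $F$ is locally Lipschitz in $x$ uniformly in $t$ if for each $x_0$ there exists $L$ such that $|F(t,x)-F(t,y)|\le L|x-y|$ for all $x,y$ in a neighbourhood of $x_0$ and all $t\in\mathbb{R}$. Class $\mathcal{K}$: continuous strictly increasing $\gamma:\mathbb{R}_{\ge0}\to\mathbb{R}_{\ge0}$ with $\gamma(0)=0$; class $\mathcal{K}_\infty$: in addition $\gamma(s)\to\infty$ as $s\to\infty$. The origin is uniformly globally stable (UGS) if there is $\gamma\in\mathcal{K}_\infty$ such that for each $(t_\circ,x_\circ)\in\mathbb{R}\times\mathbb{R}^n$ each solution satisfies $|x(t,t_\circ,x_\circ)|\le\gamma(|x_\circ|)$ for all $t\ge t_\circ$. It is uniformly globally attractive if for each $r,\sigma>0$ there is $T>0$ such that $|x_\circ|\le r$ implies $|x(t,t_\circ,x_\circ)|\le\sigma$ for all $t\ge t_\circ+T$ (for all $t_\circ\in\mathbb{R}$, with $T$ independent of $t_\circ$). It is UGAS if it is UGS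 and uniformly globally attractive. A function $\phi:\mathbb{R}\times\mathbb{R}^n\to\mathbb{R}^m$, with $t\mapsto\phi(t,x)$ locally integrable, is u$\delta$-PE with respect to (the whole state) $x$ if for each $x\in\mathbb{R}^n\setminus\{0\}$ there exist $\delta>0$, $T>0$, $\mu>0$ such that for all $t\in\mathbb{R}$: $|z-x|\le\delta$ implies $\int_t^{t+T}|\phi(\tau,z)|\,d\tau\ge\mu$. *)

theory Defs
  imports "HOL-Analysis.Analysis"
begin

definition locally_lipschitz_unif ::
    "(real \<Rightarrow> real ^ 'n \<Rightarrow> real ^ 'm) \<Rightarrow> bool" where
  "locally_lipschitz_unif F \<longleftrightarrow>
     (\<forall>x0. \<exists>L U. open U \<and> x0 \<in> U \<and> (\<forall>t. L-lipschitz_on U (F t)))"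

definition locally_integrable :: "(real \<Rightarrow> real ^ 'm) \<Rightarrow> bool" where
  "locally_integrable f \<longleftrightarrow> (\<forall>a b. f absolutely_integrable_on {a..b})"

(* F need only be integrable in time, so a solution on the interval J, with left endpoint t0,
   is a Caratheodory solution, i.e. a solution of the integral equation in the Lebesgue sense;
   it need not be differentiable everywhere. The equation at t = t0 says x t0 = x0. *)
definition is_solution ::
    "(real \<Rightarrow> real ^ 'n \<Rightarrow> real ^ 'n) \<Rightarrow> real \<Rightarrow> real ^ 'n \<Rightarrow> real set
       \<Rightarrow> (real \<Rightarrow> real ^ 'n) \<Rightarrow> bool" where
  "is_solution F t0 x0 J x \<longleftrightarrow>
     (\<forall>t\<in>J. (\<lambda>s. F s (x s)) absolutely_integrable_on {t0..t} \<and>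
            x t = x0 + integral {t0..t} (\<lambda>s. F s (x s)))"

definition solutions_exist :: "(real \<Rightarrow> real ^ 'n \<Rightarrow> real ^ 'n) \<Rightarrow> bool" where
  "solutions_exist F \<longleftrightarrow> (\<forall>t0 x0. \<forall>t1>t0. \<exists>x. is_solution F t0 x0 {t0..t1} x)"

(* Functions on the nonnegative reals are represented by functions on all reals, whose values
   at negative arguments are irrelevant. *)
definition class_K :: "(real \<Rightarrow> real) \<Rightarrow> bool" where
  "class_K \<gamma> \<longleftrightarrow> \<gamma> ` {0..} \<subseteq> {0..} \<and> continuous_on {0..} \<gamma> \<and> strict_mono_on {0..} \<gamma> \<and> \<gamma> 0 = 0"

definition class_K_inf :: "(real \<Rightarrow> real) \<Rightarrow> bool" where
  "class_K_inf \<gamma> \<longleftrightarrow> class_K \<gamma> \<and> filterlim \<gamma> at_top at_top"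

definition UGS :: "(real \<Rightarrow> real ^ 'n \<Rightarrow> real ^ 'n) \<Rightarrow> bool" where
  "UGS F \<longleftrightarrow>
     (\<exists>\<gamma>. class_K_inf \<gamma> \<and>
        (\<forall>t0 x0 x. is_solution F t0 x0 {t0..} x \<longrightarrow> (\<forall>t\<ge>t0. norm (x t) \<le> \<gamma> (norm x0))))"

definition unif_glob_attractive :: "(real \<Rightarrow> real ^ 'n \<Rightarrow> real ^ 'n) \<Rightarrow> bool" where
  "unif_glob_attractive F \<longleftrightarrow>
     (\<forall>r>0. \<forall>\<sigma>>0. \<exists>T>0. \<forall>t0 x0 x.
        norm x0 \<le> r \<longrightarrow> is_solution F t0 x0 {t0..} x \<longrightarrow> (\<forall>t\<ge>t0 + T. norm (x t) \<le> \<sigma>))"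

definition UGAS :: "(real \<Rightarrow> real ^ 'n \<Rightarrow> real ^ 'n) \<Rightarrow> bool" where
  "UGAS F \<longleftrightarrow> UGS F \<and> unif_glob_attractive F"

definition udelta_PE :: "(real \<Rightarrow> real ^ 'n \<Rightarrow> real ^ 'm) \<Rightarrow> bool" where
  "udelta_PE \<phi> \<longleftrightarrow>
     (\<forall>x. locally_integrable (\<lambda>t. \<phi> t x)) \<and>
     (\<forall>x. x \<noteq> 0 \<longrightarrow>
        (\<exists>\<delta>>0. \<exists>T>0. \<exists>\<mu>>0. \<forall>t z. norm (z - x) \<le> \<delta> \<longrightarrow>
           integral {t..t + T} (\<lambda>\<tau>. norm (\<phi> \<tau> z)) \<ge> \<mu>))"

end

theory Submission
  imports Defs
begin

text \<open>A trajectory that starts at a point \<open>z \<noteq> 0\<close> can move only if \<open>F\<close> acts near \<open>z\<close>. By the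
  Lipschitz condition and Gronwall's argument, if the integral of \<open>|F(\<tau>, z)|\<close> over \<open>[t, t + T]\<close> is
  at most a small \<open>\<mu>\<close>, then a trajectory starting at \<open>(t, z)\<close> is displaced over the time \<open>T\<close> by less
  than \<open>2 \<mu> e\<^sup>L\<^sup>T\<close> (lemma \<open>solution_stays_near\<close>). Uniform attractivity, on the other hand, gives one
  time \<open>T\<close>, independent of \<open>t\<close>, after which all trajectories that start near a given \<open>x \<noteq> 0\<close> are close
  to the origin, hence far from \<open>x\<close>. So the integral cannot be small, and the lower bound obtained
  depends only on \<open>T\<close>, on \<open>|x|\<close>, and on the Lipschitz constant \<open>L\<close> and the size of the neighbourhood
  of \<open>x\<close> where it is valid.

  Attractivity speaks of solutions defined for all future time, whereas existence is assumed on
  bounded intervals only, and the solutions chosen on growing intervals need not extend each other.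
  A global solution is therefore built by concatenating solutions on consecutive intervals of unit
  length, each starting where the previous one ends (lemma \<open>global_solution_exists\<close>).\<close>

section \<open>Concatenation of solutions\<close>

lemma is_solutionD:
  assumes "is_solution F a x0 J x" and "t \<in> J"
  shows "(\<lambda>s. F s (x s)) absolutely_integrable_on {a..t}"
    and "x t = x0 + integral {a..t} (\<lambda>s. F s (x s))"
  using assms unfolding is_solution_def by blast+

lemma is_solution_cong:
  assumes "is_solution F a x0 {a..b} y" and "\<And>s. s \<in> {a..b} \<Longrightarrow> x s = y s"
  shows "is_solution F a x0 {a..b} x"
  unfolding is_solution_def
proof (intro ballI conjI)
  fix t assume t: "t \<in> {a..b}"
  have eq: "F s (x s) = F s (y s)" if "s \<in> {a..t}" for s
    using assms(2)[of s] that t by simp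
  have sol: "(\<lambda>s. F s (y s)) absolutely_integrable_on {a..t}"
    "y t = x0 + integral {a..t} (\<lambda>s. F s (y s))"
    using is_solutionD[OF assms(1) t] by blast+
  have "(\<lambda>s. F s (x s)) absolutely_integrable_on {a..t} \<longleftrightarrow>
      (\<lambda>s. F s (y s)) absolutely_integrable_on {a..t}"
    by (intro set_integrable_cong refl eq)
  then show "(\<lambda>s. F s (x s)) absolutely_integrable_on {a..t}"
    using sol(1) by (rule iffD2)
  have "integral {a..t} (\<lambda>s. F s (x s)) = integral {a..t} (\<lambda>s. F s (y s))"
    by (intro Henstock_Kurzweil_Integration.integral_cong eq)
  then show "x t = x0 + integral {a..t} (\<lambda>s. F s (x s))"
    using sol(2) assms(2)[OF t] by (simp only:)
qed

lemma is_solution_concat: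
  assumes left: "is_solution F a x0 {a..b} x" and right: "is_solution F b (x b) {b..c} x"
    and "a \<le> b"
  shows "is_solution F a x0 {a..c} x"
  unfolding is_solution_def
proof (intro ballI)
  fix t assume t: "t \<in> {a..c}"
  show "(\<lambda>s. F s (x s)) absolutely_integrable_on {a..t} \<and>
    x t = x0 + integral {a..t} (\<lambda>s. F s (x s))"
  proof (cases "t \<le> b")
    case True
    then show ?thesis using left t unfolding is_solution_def by auto
  next
    case False
    have 1: "(\<lambda>s. F s (x s)) absolutely_integrable_on {a..b}"
      "x b = x0 + integral {a..b} (\<lambda>s. F s (x s))"
      by (rule is_solutionD[OF left]; use \<open>a \<le> b\<close> in simp)+
    have 2: "(\<lambda>s. F s (x s)) absolutely_integrable_on {b..t}"
      "x t = x b + integral {b..t} (\<lambda>s. F s (x s))"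
      by (rule is_solutionD[OF right]; use False t in simp)+
    have 3: "(\<lambda>s. F s (x s)) absolutely_integrable_on {a..t}"
      using absolutely_integrable_Un[OF 1(1) 2(1)] False \<open>a \<le> b\<close>
      by (simp add: ivl_disj_un_two_touch)
    have "integral {a..b} (\<lambda>s. F s (x s)) + integral {b..t} (\<lambda>s. F s (x s))
        = integral {a..t} (\<lambda>s. F s (x s))"
      using False \<open>a \<le> b\<close> 3
      by (intro Henstock_Kurzweil_Integration.integral_combine)
         (auto simp: absolutely_integrable_on_def)
    then show ?thesis using 1(2) 2(2) 3 by (metis add.assoc)
  qed
qed

lemma is_solution_initial_value:
  assumes "is_solution F a x0 J x" and "a \<in> J"
  shows "x a = x0"
  using is_solutionD(2)[OF assms] by simp

lemma global_solution_exists: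
  assumes "solutions_exist F"
  shows "\<exists>x. is_solution F t0 x0 {t0..} x"
proof -
  have "\<exists>x. is_solution F a p {a..a + 1} x" for a p
    using assms unfolding solutions_exist_def by simp
  then obtain S where S: "\<And>a p. is_solution F a p {a..a + 1} (S a p)" by metis
  define p where "p = rec_nat x0 (\<lambda>k q. S (t0 + real k) q (t0 + real k + 1))"
  define y where "y k = S (t0 + real k) (p k)" for k
  have p0: "p 0 = x0" by (simp add: p_def)
  have pSuc: "p (Suc k) = y k (t0 + real k + 1)" for k by (simp add: p_def y_def)
  have y: "is_solution F (t0 + real k) (p k) {t0 + real k..t0 + real k + 1} (y k)" for k
    unfolding y_def by (rule S)
  have y_start: "y k (t0 + real k) = p k" for k
    using is_solution_initial_value[OF y] by simp
  define x where "x s = y (nat \<lfloor>s - t0\<rfloor>) s" for s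
  have x_start: "x (t0 + real k) = p k" for k
    by (simp add: x_def y_start)
  \<comment> \<open>At the right endpoint the floor already selects the next piece, which starts where the
    current one ends.\<close>
  have x_eq: "x s = y k s" if "s \<in> {t0 + real k..t0 + real k + 1}" for k s
  proof (cases "s = t0 + real k + 1")
    case True
    then show ?thesis using x_start[of "Suc k"] pSuc[of k] by (simp add: algebra_simps)
  next
    case False
    then have "\<lfloor>s - t0\<rfloor> = int k" using that by (simp add: floor_eq_iff)
    then show ?thesis by (simp add: x_def)
  qed
  have pieces: "is_solution F (t0 + real k) (x (t0 + real k)) {t0 + real k..t0 + real k + 1} x" for k
    unfolding x_start using y x_eq by (rule is_solution_cong)
  have bounded: "is_solution F t0 x0 {t0..t0 + real k + 1} x" for k
  proof (induction k)
    case 0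
    show ?case using pieces[of 0] x_start[of 0] p0 by simp
  next
    case (Suc k)
    show ?case
    proof (rule is_solution_concat[OF Suc])
      show "is_solution F (t0 + real k + 1) (x (t0 + real k + 1))
          {t0 + real k + 1..t0 + real (Suc k) + 1} x"
        using pieces[of "Suc k"] by (simp add: algebra_simps)
    qed simp
  qed
  have "is_solution F t0 x0 {t0..} x"
    unfolding is_solution_def
  proof (intro ballI)
    fix t assume "t \<in> {t0..}"
    moreover obtain k where "t - t0 \<le> real k" using real_arch_simple by blast
    ultimately have "t \<in> {t0..t0 + real k + 1}" by simp
    then show "(\<lambda>s. F s (x s)) absolutely_integrable_on {t0..t} \<and>
        x t = x0 + integral {t0..t} (\<lambda>s. F s (x s))"
      using bounded[of k] unfolding is_solution_def by blast
  qed
  then show ?thesis by blast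
qed

section \<open>Displacement of a solution under weak excitation\<close>

lemma is_solution_continuous_on:
  assumes "is_solution F a x0 J x" and "{a..b} \<subseteq> J"
  shows "continuous_on {a..b} x"
proof (cases "a \<le> b")
  case True
  then have "b \<in> J" using assms(2) by auto
  then have "(\<lambda>s. F s (x s)) integrable_on {a..b}"
    using set_lebesgue_integral_eq_integral(1)[OF is_solutionD(1)[OF assms(1)]] by blast
  then have "continuous_on {a..b} (\<lambda>t. integral {a..t} (\<lambda>s. F s (x s)))"
    by (rule indefinite_integral_continuous_1)
  then have "continuous_on {a..b} (\<lambda>t. x0 + integral {a..t} (\<lambda>s. F s (x s)))"
    by (rule continuous_on_add[OF continuous_on_const])
  moreover have "x0 + integral {a..t} (\<lambda>s. F s (x s)) = x t" if "t \<in> {a..b}" for t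
    using is_solutionD(2)[OF assms(1), of t] assms(2) that by (metis subsetD)
  ultimately show ?thesis by (rule continuous_on_eq)
qed simp

text \<open>The integral equation gives the displacement at time \<open>s\<close> as at most \<open>\<mu>\<close> plus \<open>L\<close> times the
  integral of the displacement, but only while the solution is in the ball where \<open>F\<close> is Lipschitz.
  The factor 2 in the bound settles both this and Gronwall's inequality: at the first time at which
  the bound is attained, the solution has not left the ball, and the integral inequality then
  makes the displacement at most the bound minus \<open>\<mu>\<close>.\<close>
lemma solution_stays_near:
  fixes F :: "real \<Rightarrow> real ^ 'n \<Rightarrow> real ^ 'n"
  assumes sol: "is_solution F t z {t..t + T} x"
    and lip: "\<And>\<tau>. L-lipschitz_on (cball z r) (F \<tau>)"
    and int: "(\<lambda>\<tau>. F \<tau> z) absolutely_integrable_on {t..t + T}"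
    and weak: "integral {t..t + T} (\<lambda>\<tau>. norm (F \<tau> z)) \<le> \<mu>"
    and \<mu>: "0 < \<mu>" "2 * \<mu> * exp (L * T) \<le> r"
    and s: "s \<in> {t..t + T}"
  shows "norm (x s - z) < 2 * \<mu> * exp (L * (s - t))"
proof (rule ccontr)
  assume neg: "\<not> ?thesis"
  define h where "h \<tau> = norm (x \<tau> - z) - 2 * \<mu> * exp (L * (\<tau> - t))" for \<tau>
  have L: "0 \<le> L" using lip[of 0] lipschitz_on_nonneg by blast
  have cont: "continuous_on {t..t + T} h"
    unfolding h_def using is_solution_continuous_on[OF sol] by (intro continuous_intros) auto
  have ht: "h t < 0"
    using is_solution_initial_value[OF sol] s \<mu> by (simp add: h_def)
  define A where "A = {\<tau> \<in> {t..t + T}. 0 \<le> h \<tau>}"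
  have "closed A"
    unfolding A_def by (intro continuous_on_closed_Collect_le continuous_on_const cont closed_atLeastAtMost)
  moreover have "A \<subseteq> {t..t + T}" by (auto simp: A_def)
  ultimately have "compact A"
    using bounded_subset[OF bounded_closed_interval] by (simp add: compact_eq_bounded_closed)
  moreover have "s \<in> A" using neg s by (simp add: A_def h_def)
  ultimately obtain e where e: "e \<in> A" and first: "\<And>\<tau>. \<tau> \<in> A \<Longrightarrow> e \<le> \<tau>"
    using compact_attains_inf[of A] by blast
  have e_in: "t \<le> e" "e \<le> t + T" using e by (auto simp: A_def)
  \<comment> \<open>Attained with equality, so that the bound also holds at the endpoint \<open>e\<close> itself.\<close>
  have "\<exists>\<tau>. t \<le> \<tau> \<and> \<tau> \<le> e \<and> h \<tau> = 0"
    using ht e e_in by (intro IVT' continuous_on_subset[OF cont]) (auto simp: A_def)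
  then have he: "h e = 0" using first e_in by (force simp: A_def)
  have below: "norm (x \<tau> - z) \<le> 2 * \<mu> * exp (L * (\<tau> - t))" if "\<tau> \<in> {t..e}" for \<tau>
  proof (cases "\<tau> = e")
    case False
    then have "\<tau> \<notin> A" using first that by force
    then show ?thesis using that e_in by (simp add: A_def h_def)
  qed (use he in \<open>simp add: h_def\<close>)
  have pointwise: "norm (F \<tau> (x \<tau>)) \<le> norm (F \<tau> z) + L * (2 * \<mu> * exp (L * (\<tau> - t)))"
    if \<tau>: "\<tau> \<in> {t..e}" for \<tau>
  proof -
    have "exp (L * (\<tau> - t)) \<le> exp (L * T)" using L \<tau> e_in by (simp add: mult_left_mono)
    then have "2 * \<mu> * exp (L * (\<tau> - t)) \<le> 2 * \<mu> * exp (L * T)" using \<mu> by simp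
    then have "norm (x \<tau> - z) \<le> r" using below[OF \<tau>] \<mu>(2) by linarith
    moreover from this have "0 \<le> r" by (meson norm_ge_zero order_trans)
    ultimately have "norm (F \<tau> (x \<tau>) - F \<tau> z) \<le> L * norm (x \<tau> - z)"
      using lipschitz_onD[OF lip, of "x \<tau>" z \<tau>] by (simp add: dist_norm norm_minus_commute)
    also have "\<dots> \<le> L * (2 * \<mu> * exp (L * (\<tau> - t)))"
      using below[OF \<tau>] L by (rule mult_left_mono)
    finally show ?thesis using norm_triangle_sub[of "F \<tau> (x \<tau>)" "F \<tau> z"] by linarith
  qed
  have exp_int: "((\<lambda>\<tau>. L * (2 * \<mu> * exp (L * (\<tau> - t)))) has_integral
      2 * \<mu> * exp (L * (e - t)) - 2 * \<mu> * exp (L * (t - t))) {t..e}"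
    using e_in(1)
    by (intro fundamental_theorem_of_calculus)
       (auto intro!: derivative_eq_intros simp flip: has_real_derivative_iff_has_vector_derivative)
  have norm_int: "(\<lambda>\<tau>. norm (F \<tau> z)) integrable_on {t..t + T}"
    using int by (simp add: absolutely_integrable_on_def)
  then have norm_int_e: "(\<lambda>\<tau>. norm (F \<tau> z)) integrable_on {t..e}"
    using e_in by (auto intro: integrable_on_subinterval)
  have F_int: "(\<lambda>\<tau>. F \<tau> (x \<tau>)) integrable_on {t..e}"
    and x_e: "x e = z + integral {t..e} (\<lambda>\<tau>. F \<tau> (x \<tau>))"
    using is_solutionD[OF sol, of e] e_in by (simp_all add: absolutely_integrable_on_def)
  have "norm (x e - z) = norm (integral {t..e} (\<lambda>\<tau>. F \<tau> (x \<tau>)))"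
    by (subst x_e) simp
  also have "\<dots> \<le> integral {t..e} (\<lambda>\<tau>. norm (F \<tau> z) + L * (2 * \<mu> * exp (L * (\<tau> - t))))"
    using F_int norm_int_e exp_int pointwise
    by (intro integral_norm_bound_integral integrable_add) auto
  also have "\<dots> = integral {t..e} (\<lambda>\<tau>. norm (F \<tau> z)) + (2 * \<mu> * exp (L * (e - t)) - 2 * \<mu>)"
    using integral_unique[OF exp_int] norm_int_e exp_int
    by (subst Henstock_Kurzweil_Integration.integral_add) auto
  also have "integral {t..e} (\<lambda>\<tau>. norm (F \<tau> z)) \<le> integral {t..t + T} (\<lambda>\<tau>. norm (F \<tau> z))"
    using e_in norm_int norm_int_e by (intro integral_subset_le) auto
  finally have "norm (x e - z) \<le> 2 * \<mu> * exp (L * (e - t)) - \<mu>" using weak by linarith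
  then show False using he \<mu>(1) by (simp add: h_def)
qed

section \<open>Persistency of excitation\<close>

theorem theorem1:
  fixes F :: "real \<Rightarrow> real ^ 'n \<Rightarrow> real ^ 'n"
  assumes "locally_lipschitz_unif F"
    and "\<And>x. locally_integrable (\<lambda>t. F t x)"
    and "solutions_exist F"
    and "UGAS F"
  shows "udelta_PE F"
  unfolding udelta_PE_def
proof (intro conjI allI impI)
  fix x :: "real ^ 'n"
  show "locally_integrable (\<lambda>t. F t x)" by (rule assms(2))
next
  fix x :: "real ^ 'n"
  assume "x \<noteq> 0"
  obtain L U where U: "open U" "x \<in> U" and lip: "\<And>t. L-lipschitz_on U (F t)"
    using assms(1) unfolding locally_lipschitz_unif_def by metis
  obtain d where d: "d > 0" "cball x d \<subseteq> U" using U open_contains_cball by blast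
  \<comment> \<open>A start within \<open>\<delta>\<close> of \<open>x\<close>, a displacement below \<open>\<delta>\<close> and a final norm of at most \<open>|x| / 4\<close>
    are incompatible once \<open>\<delta> \<le> |x| / 4\<close>; and the ball of radius \<open>\<delta>\<close> around such a start lies
    in the ball of radius \<open>2 \<delta> \<le> d\<close> around \<open>x\<close>, where \<open>F\<close> is Lipschitz.\<close>
  define \<delta> where "\<delta> = min (d / 2) (norm x / 4)"
  have \<delta>: "\<delta> > 0" "2 * \<delta> \<le> d" "4 * \<delta> \<le> norm x" using d \<open>x \<noteq> 0\<close> by (auto simp: \<delta>_def)
  have "norm x + \<delta> > 0" "norm x / 4 > 0" using \<delta> \<open>x \<noteq> 0\<close> by (simp_all add: add_nonneg_pos)
  then obtain T where T: "T > 0" and attr: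
    "\<And>t0 x0 y t. \<lbrakk>norm x0 \<le> norm x + \<delta>; is_solution F t0 x0 {t0..} y; t \<ge> t0 + T\<rbrakk>
      \<Longrightarrow> norm (y t) \<le> norm x / 4"
    using assms(4) unfolding UGAS_def unif_glob_attractive_def by metis
  define \<mu> where "\<mu> = \<delta> / (2 * exp (L * T))"
  have \<mu>: "\<mu> > 0" "2 * \<mu> * exp (L * T) = \<delta>" using \<delta> by (simp_all add: \<mu>_def)
  have "integral {t..t + T} (\<lambda>\<tau>. norm (F \<tau> z)) \<ge> \<mu>" if z: "norm (z - x) \<le> \<delta>" for t z
  proof (rule ccontr)
    assume weak: "\<not> ?thesis"
    obtain y where y: "is_solution F t z {t..} y"
      using global_solution_exists[OF assms(3)] by blast
    have "cball z \<delta> \<subseteq> cball x d"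
      using z \<delta> by (intro cball_subset_cball_iff[THEN iffD2]) (auto simp: dist_norm)
    then have "\<And>\<tau>. L-lipschitz_on (cball z \<delta>) (F \<tau>)"
      using lipschitz_on_subset[OF lip] d(2) by blast
    moreover have "is_solution F t z {t..t + T} y"
      using y unfolding is_solution_def by auto
    moreover have "(\<lambda>\<tau>. F \<tau> z) absolutely_integrable_on {t..t + T}"
      using assms(2) unfolding locally_integrable_def by blast
    ultimately have "norm (y (t + T) - z) < 2 * \<mu> * exp (L * (t + T - t))"
      using weak \<mu> T by (intro solution_stays_near[where T = T and r = \<delta>]) auto
    then have "norm (y (t + T) - z) < \<delta>" using \<mu>(2) by simp
    moreover have "norm (y (t + T)) \<le> norm x / 4"
    proof (rule attr[OF _ y])
      show "norm z \<le> norm x + \<delta>" using z norm_triangle_sub[of z x] by linarith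
    qed simp
    moreover have "norm x \<le> norm (y (t + T)) + norm (y (t + T) - z) + norm (z - x)"
      using norm_triangle_sub[of x z] norm_triangle_sub[of z "y (t + T)"]
      by (simp add: norm_minus_commute)
    ultimately show False using z \<delta>(1,3) by linarith
  qed
  then show "\<exists>\<delta>>0. \<exists>T>0. \<exists>\<mu>>0. \<forall>t z. norm (z - x) \<le> \<delta> \<longrightarrow>
      integral {t..t + T} (\<lambda>\<tau>. norm (F \<tau> z)) \<ge> \<mu>"
    using \<delta>(1) T \<mu>(1) by blast
qed

end
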